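(* Let $G$ be a group and let $\partial:M\to L$ be a $G$-equivariant crossed module which is faithful. Then any weak $(M\xrightarrow{\partial}L)$-bitorsor is also an $(M\xrightarrow{\partial}L)$-bitorsor (with the same map $\alpha:P\to L$).
   Context: Groups are written multiplicatively. A crossed module $\partial:M\to L$ is a group homomorphism with an action $(\tau,m)\mapsto{}^\tau m$ of $L$ on $M$ by automorphisms such that $\partial({}^\tau m)=\tau\partial(m)\tau^{-1}$ and ${}^{\partial(n)}m=nmn^{-1}$. It is $G$-equivariant if $G$ acts on $M$ and $L$ by group automorphisms with $\partial({}^xm)={}^x\partial(m)$ and ${}^x({}^\tau m)={}^{({}^x\tau)}({}^xm)$. It is faithful if ${}^\tau m={}^{\tau'}m$ for all $m\in M$ implies $\tau=\tau'$, i.e. the action homomorphism $L\to\mathrm{Aut}(M)$ is injective. A right $M$-torsor is a nonempty set $P$ with a right action of $M$ and a left action of $G$ such that ${}^x(pm)={}^xp\,{}^xm$, and such that for all $p,q\in P$ there is a unique $m\in M$ with $q=pm$. An $(M\xrightarrow{\partial}L)$-bitorsor is a pair $(P,\alpha)$ with $P$ a right $M$-torsor and $\alpha:P\to L$ a function with $\alpha({}^xp)={}^x\alpha(p)$ for $x\in G$ and $\alpha(pm)=\alpha(p)\partial(m)$ for $m\in M$. A weak $(M\xrightarrow{\partial}L)$-bitorsor is a left $G$-set $P$ on which $M$ acts on the left and on the right such that $(mp)n=m(pn)$, ${}^g(pm)={}^gp\,{}^gm$, ${}^g(mp)={}^gm\,{}^gp$ for all $m,n\in M$, $g\in G$, $p\in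 P$, such that $P$ is a right $M$-torsor, together with a map $\alpha:P\to L$ such that $mp=p\,({}^{\xi(p)}m)$ for all $m\in M$, $p\in P$, where $\xi(p)=\alpha(p)^{-1}$. *)

theory Defs
  imports "HOL-Algebra.Group_Action"
begin

text \<open>
  The group-action locales of the library represent an action by a homomorphism into
  \<^term>\<open>BijGroup E\<close> or \<^term>\<open>AutoGroup M\<close>. Their elements are extensional functions, so two
  group elements have equal images exactly when they act equally at every point of the carrier.
\<close>

locale automorphism_action = G: group G + M: group M for G and M +
  fixes act :: "'g \<Rightarrow> 'm \<Rightarrow> 'm"
  assumes act_hom: "act \<in> hom G (AutoGroup M)"

locale crossed_module =
  boundary: group_hom M L bd + action: automorphism_action L M act
  for M and L and bd and act +
  assumes bd_act:
    "\<lbrakk>t \<in> carrier L; m \<in> carrier M\<rbrakk> \<Longrightarrow> bd (act t m) = t \<otimes>\<^bsub>L\<^esub> bd m \<otimes>\<^bsub>L\<^esub> inv\<^bsub>L\<^esub> t"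
  and act_bd:
    "\<lbrakk>n \<in> carrier M; m \<in> carrier M\<rbrakk> \<Longrightarrow> act (bd n) m = n \<otimes>\<^bsub>M\<^esub> m \<otimes>\<^bsub>M\<^esub> inv\<^bsub>M\<^esub> n"

locale equivariant_crossed_module =
  crossed_module M L bd act +
  on_M: automorphism_action G M gM +
  on_L: automorphism_action G L gL
  for G and M and L and bd and act and gM and gL +
  assumes bd_equivariant:
    "\<lbrakk>x \<in> carrier G; m \<in> carrier M\<rbrakk> \<Longrightarrow> bd (gM x m) = gL x (bd m)"
  and act_equivariant:
    "\<lbrakk>x \<in> carrier G; t \<in> carrier L; m \<in> carrier M\<rbrakk> \<Longrightarrow> gM x (act t m) = act (gL x t) (gM x m)"

locale faithful_equivariant_crossed_module =
  equivariant_crossed_module G M L bd act gM gL +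
  faithful_action L "carrier M" act
  for G and M and L and bd and act and gM and gL

locale right_group_action = group M for M +
  fixes P :: "'p set" and ract :: "'p \<Rightarrow> 'm \<Rightarrow> 'p"
  assumes ract_closed: "\<lbrakk>p \<in> P; m \<in> carrier M\<rbrakk> \<Longrightarrow> ract p m \<in> P"
  and ract_one: "p \<in> P \<Longrightarrow> ract p \<one>\<^bsub>M\<^esub> = p"
  and ract_mult: "\<lbrakk>p \<in> P; m \<in> carrier M; n \<in> carrier M\<rbrakk> \<Longrightarrow>
    ract p (m \<otimes>\<^bsub>M\<^esub> n) = ract (ract p m) n"

locale right_torsor =
  on_M: automorphism_action G M gM +
  on_P: group_action G P gP +
  right: right_group_action M P ract
  for G and M and gM and P and gP and ract +
  assumes nonempty: "P \<noteq> {}"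
  and gP_ract: "\<lbrakk>x \<in> carrier G; p \<in> P; m \<in> carrier M\<rbrakk> \<Longrightarrow>
    gP x (ract p m) = ract (gP x p) (gM x m)"
  and ex1_translation: "\<lbrakk>p \<in> P; q \<in> P\<rbrakk> \<Longrightarrow> \<exists>!m. m \<in> carrier M \<and> q = ract p m"

locale bitorsor =
  equivariant_crossed_module G M L bd act gM gL +
  right_torsor G M gM P gP ract
  for G and M and L and bd and act and gM and gL and P and gP and ract +
  fixes \<alpha> :: "'p \<Rightarrow> 'l"
  assumes \<alpha>_closed: "\<alpha> \<in> P \<rightarrow> carrier L"
  and \<alpha>_equivariant: "\<lbrakk>x \<in> carrier G; p \<in> P\<rbrakk> \<Longrightarrow> \<alpha> (gP x p) = gL x (\<alpha> p)"
  and \<alpha>_ract: "\<lbrakk>p \<in> P; m \<in> carrier M\<rbrakk> \<Longrightarrow> \<alpha> (ract p m) = \<alpha> p \<otimes>\<^bsub>L\<^esub> bd m"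

text \<open>
  The compatibility of the action of \<open>G\<close> with the right action of \<open>M\<close> is part of
  \<^locale>\<open>right_torsor\<close>.
\<close>

locale weak_bitorsor =
  equivariant_crossed_module G M L bd act gM gL +
  right_torsor G M gM P gP ract +
  left: group_action M P lact
  for G and M and L and bd and act and gM and gL and P and gP and lact and ract +
  fixes \<alpha> :: "'p \<Rightarrow> 'l"
  assumes \<alpha>_closed: "\<alpha> \<in> P \<rightarrow> carrier L"
  and lact_ract: "\<lbrakk>m \<in> carrier M; n \<in> carrier M; p \<in> P\<rbrakk> \<Longrightarrow>
    ract (lact m p) n = lact m (ract p n)"
  and gP_lact: "\<lbrakk>x \<in> carrier G; m \<in> carrier M; p \<in> P\<rbrakk> \<Longrightarrow>
    gP x (lact m p) = lact (gM x m) (gP x p)"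
  and lact_eq: "\<lbrakk>m \<in> carrier M; p \<in> P\<rbrakk> \<Longrightarrow>
    lact m p = ract p (act (inv\<^bsub>L\<^esub> (\<alpha> p)) m)"

end

theory Submission
  imports Defs
begin

text \<open>
  By faithfulness, each of the two identities for \<open>\<alpha>\<close> only has to be checked on the action of the
  inverses on \<open>M\<close>. That action is recovered from \<open>m p = p (act (\<alpha> p)\<^sup>-\<^sup>1 m)\<close> by cancelling \<open>p\<close>:
  computing \<open>m (p n) = (m p) n\<close> in two ways gives \<open>\<alpha> (p n)\<close>, and computing \<open>x (m p)\<close> in two ways
  gives \<open>\<alpha> (x p)\<close>.
\<close>

context automorphism_action
begin

lemma act_closed [simp]: "\<lbrakk>g \<in> carrier G; m \<in> carrier M\<rbrakk> \<Longrightarrow> act g m \<in> carrier M"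
  using hom_in_carrier[OF act_hom, of g]
  by (auto simp: AutoGroup_def BijGroup_def auto_def hom_def)

lemma act_mult:
  "\<lbrakk>g \<in> carrier G; h \<in> carrier G; m \<in> carrier M\<rbrakk> \<Longrightarrow> act (g \<otimes>\<^bsub>G\<^esub> h) m = act g (act h m)"
  using hom_mult[OF act_hom, of g h] hom_in_carrier[OF act_hom, of g] hom_in_carrier[OF act_hom, of h]
  by (simp add: AutoGroup_def BijGroup_def auto_def compose_def)

text \<open>Serves to write an arbitrary element of \<open>M\<close> as a translate under
  \<open>G\<close>, the only form to which \<open>act_equivariant\<close> applies.\<close>

lemma act_surj: "g \<in> carrier G \<Longrightarrow> act g ` carrier M = carrier M"
  using hom_in_carrier[OF act_hom, of g]
  by (simp add: AutoGroup_def BijGroup_def auto_def Bij_def bij_betw_def)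

lemma act_in_hom: "g \<in> carrier G \<Longrightarrow> act g \<in> hom M M"
  using hom_in_carrier[OF act_hom, of g] by (simp add: AutoGroup_def auto_def)

end

text \<open>Injectivity of \<open>\<phi>\<close> compares whole functions. Since its values are
  extensional on \<open>E\<close>, agreement on \<open>E\<close> already makes them equal.\<close>

lemma (in faithful_action) faithful_eqI:
  assumes "g \<in> carrier G" "h \<in> carrier G"
    and "\<And>x. x \<in> E \<Longrightarrow> \<phi> g x = \<phi> h x"
  shows "g = h"
proof -
  have "\<phi> g \<in> extensional E" "\<phi> h \<in> extensional E"
    using assms(1,2) by (simp_all add: bij_prop0 Bij_imp_extensional)
  then have "\<phi> g = \<phi> h"
    using assms(3) by (rule extensionalityI)
  then show ?thesis
    using assms(1,2) faithful by (auto dest: inj_onD)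
qed

lemma (in right_torsor) ract_cancel:
  "\<lbrakk>p \<in> P; m \<in> carrier M; n \<in> carrier M; ract p m = ract p n\<rbrakk> \<Longrightarrow> m = n"
  using ex1_translation[of p "ract p m"] right.ract_closed[of p m] by metis

context weak_bitorsor
begin

lemma \<alpha>_in_carrier [simp]: "p \<in> P \<Longrightarrow> \<alpha> p \<in> carrier L"
  using \<alpha>_closed by auto

text \<open>Cancelling \<open>p\<close> in \<open>(m p) n = m (p n)\<close> leaves
  \<open>?a n = n ?b\<close>, so \<open>?b\<close> is the conjugate of \<open>?a\<close> by the
  inverse of \<open>n\<close>, and such a conjugation is an action through
  \<open>bd\<close>.\<close>

lemma act_inv_\<alpha>_ract:
  assumes p: "p \<in> P" and n: "n \<in> carrier M" and m: "m \<in> carrier M"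
  shows "act (inv\<^bsub>L\<^esub> (\<alpha> (ract p n))) m = act (inv\<^bsub>L\<^esub> (\<alpha> p \<otimes>\<^bsub>L\<^esub> bd n)) m"
proof -
  let ?a = "act (inv\<^bsub>L\<^esub> (\<alpha> p)) m" and ?b = "act (inv\<^bsub>L\<^esub> (\<alpha> (ract p n))) m"
  have q: "ract p n \<in> P"
    using p n by (rule right.ract_closed)
  have a: "?a \<in> carrier M" and b: "?b \<in> carrier M"
    using p q m by simp_all
  have "ract p (?a \<otimes>\<^bsub>M\<^esub> n) = ract (lact m p) n"
    using p n m a by (simp add: right.ract_mult lact_eq)
  also have "\<dots> = lact m (ract p n)"
    using p n m by (simp add: lact_ract)
  also have "\<dots> = ract p (n \<otimes>\<^bsub>M\<^esub> ?b)"
    using p q n m b by (simp add: right.ract_mult lact_eq)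
  finally have "?a \<otimes>\<^bsub>M\<^esub> n = n \<otimes>\<^bsub>M\<^esub> ?b"
    using p n a b by (intro ract_cancel[of p]) simp_all
  then have "?b = inv\<^bsub>M\<^esub> n \<otimes>\<^bsub>M\<^esub> (?a \<otimes>\<^bsub>M\<^esub> n)"
    using n a b by (subst boundary.G.inv_solve_left) simp_all
  \<comment> \<open>This is the Peiffer identity \<open>act_bd\<close> at the inverse of
    \<open>n\<close>. The term \<open>bd (inv n)\<close> must not first become
    \<open>inv (bd n)\<close>, or \<open>act_bd\<close> no longer matches.\<close>
  also have "\<dots> = act (bd (inv\<^bsub>M\<^esub> n)) ?a"
    using n a by (simp add: act_bd boundary.G.m_assoc del: boundary.hom_inv)
  also have "\<dots> = act (inv\<^bsub>L\<^esub> (\<alpha> p \<otimes>\<^bsub>L\<^esub> bd n)) m"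
    using p n m by (simp add: action.act_mult boundary.H.inv_mult_group)
  finally show ?thesis .
qed

lemma act_inv_\<alpha>_gP:
  assumes x: "x \<in> carrier G" and p: "p \<in> P" and m: "m \<in> carrier M"
  shows "act (inv\<^bsub>L\<^esub> (\<alpha> (gP x p))) m = act (inv\<^bsub>L\<^esub> (gL x (\<alpha> p))) m"
proof -
  interpret gL: group_hom L L "gL x"
    by unfold_locales (rule on_L.act_in_hom[OF x])
  \<comment> \<open>With \<open>m\<close> as the image of \<open>k\<close>, equivariance of the left
    action gives \<open>m (x p) = x (k p)\<close>, and the defining law can be applied at both
    \<open>x p\<close> and \<open>p\<close>.\<close>
  obtain k where k: "k \<in> carrier M" and m_eq: "m = gM x k"
    using on_M.act_surj[OF x] m by blast
  have q: "gP x p \<in> P"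
    using x p by (rule on_P.element_image) simp
  have a: "act (inv\<^bsub>L\<^esub> (\<alpha> p)) k \<in> carrier M"
    using p k by simp
  have "ract (gP x p) (act (inv\<^bsub>L\<^esub> (\<alpha> (gP x p))) m) = lact (gM x k) (gP x p)"
    using q m by (simp add: lact_eq m_eq)
  also have "\<dots> = gP x (lact k p)"
    using x p k by (simp add: gP_lact)
  also have "\<dots> = gP x (ract p (act (inv\<^bsub>L\<^esub> (\<alpha> p)) k))"
    using p k by (simp add: lact_eq)
  also have "\<dots> = ract (gP x p) (act (inv\<^bsub>L\<^esub> (gL x (\<alpha> p))) m)"
    using x p k a by (simp add: gP_ract act_equivariant m_eq)
  finally show ?thesis
    using x p q m by (intro ract_cancel[of "gP x p"]) simp_all
qed

end

theorem proposition33: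
  fixes G :: "('g, 'a) monoid_scheme"
    and M :: "('m, 'b) monoid_scheme"
    and L :: "('l, 'c) monoid_scheme"
    and bd :: "'m \<Rightarrow> 'l"
    and act :: "'l \<Rightarrow> 'm \<Rightarrow> 'm"
    and gM :: "'g \<Rightarrow> 'm \<Rightarrow> 'm"
    and gL :: "'g \<Rightarrow> 'l \<Rightarrow> 'l"
    and P :: "'p set"
    and gP :: "'g \<Rightarrow> 'p \<Rightarrow> 'p"
    and lact :: "'m \<Rightarrow> 'p \<Rightarrow> 'p"
    and ract :: "'p \<Rightarrow> 'm \<Rightarrow> 'p"
    and \<alpha> :: "'p \<Rightarrow> 'l"
  assumes "group G"
    and "faithful_equivariant_crossed_module G M L bd act gM gL"
    and "weak_bitorsor G M L bd act gM gL P gP lact ract \<alpha>"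
  shows "bitorsor G M L bd act gM gL P gP ract \<alpha>"
proof -
  interpret F: faithful_equivariant_crossed_module G M L bd act gM gL
    by fact
  interpret W: weak_bitorsor G M L bd act gM gL P gP lact ract \<alpha>
    by fact
  \<comment> \<open>The weak law involves \<open>\<alpha> p\<close> only through its inverse, so
    faithfulness is applied to inverses, and injectivity of inversion then gives equality.\<close>
  have eqI: "s = t"
    if "s \<in> carrier L" "t \<in> carrier L"
      and "\<And>m. m \<in> carrier M \<Longrightarrow> act (inv\<^bsub>L\<^esub> s) m = act (inv\<^bsub>L\<^esub> t) m" for s t
  proof -
    have "inv\<^bsub>L\<^esub> s = inv\<^bsub>L\<^esub> t"
      using that by (intro F.faithful_eqI) simp_all
    then show ?thesis
      using that(1,2) F.boundary.H.inv_inj by (auto dest: inj_onD)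
  qed
  show ?thesis
  proof unfold_locales
    show "\<alpha> \<in> P \<rightarrow> carrier L"
      by (rule W.\<alpha>_closed)
    show "\<alpha> (gP x p) = gL x (\<alpha> p)" if "x \<in> carrier G" "p \<in> P" for x p
      using that by (intro eqI W.act_inv_\<alpha>_gP) (simp_all add: W.on_P.element_image)
    show "\<alpha> (ract p m) = \<alpha> p \<otimes>\<^bsub>L\<^esub> bd m" if "p \<in> P" "m \<in> carrier M" for p m
      using that by (intro eqI W.act_inv_\<alpha>_ract) (simp_all add: W.right.ract_closed)
  qed
qed

end
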